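(* Let $G$ be a graph and let $\mathcal{P} = \{V_1, \ldots, V_r\}$ be a partition of $V(G)$, where $r \ge 2$. Suppose that (a) $G$ is block-minimal with no IT (with respect to $\mathcal{P}$), (b) $G$ is the disjoint union of complete bipartite graphs, and (c) the number of components of $G$ is $r - 1$. Then $G, \mathcal{P}$ can be constructed by starting from a complete bipartite graph with its standard bipartition and iteratively adding complete bipartite graphs with the standard bipartition via join steps (as defined in the context).
   Context: Graphs are finite and simple. For a graph $G$ and a partition $\mathcal{P} = \{V_1, \ldots, V_r\}$ of $V(G)$ into (nonempty) blocks, an independent transversal (IT) of $G$ with respect to $\mathcal{P}$ is an independent set $\{v_1, \ldots, v_r\}$ of $G$ with $v_i \in V_i$ for every $i$. $G$ is block-minimal with no IT (with respect to $\mathcal{P}$) if $G$ has no IT with respect to $\mathcal{P}$ but $G - V_i$ has an IT with respect to $\mathcal{P} \setminus \{V_i\}$ for every $i \in \{1,\ldots,r\}$. $K_{A,B}$ denotes the complete bipartite graph with (nonempty) parts $A,B$; its standard bipartition is the vertex partition $\{A,B\}$. Join step: given a current vertex-partitioned graph $(H, \mathcal{Q})$, a block $W \in \mathcal{Q}$, and a complete bipartite graph $K_{A,B}$ disjoint from $H$, form the graph $H \cup K_{A,B}$ (disjoint union) with vertex partition $(\mathcal{Q} \setminus \{W\}) \cup \{A', B'\}$, where $A' \supseteq A$ and $B' \supseteq B$ are obtained by distributing each vertex of $W$ into exactly one of $A$, $B$ arbitrarily. *)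

theory Defs
  imports "Graph_Theory.Digraph_Component" "HOL-Library.Disjoint_Sets"
begin

text \<open>
  A finite simple graph is a \<open>pair_graph\<close>: a finite, loop-free digraph without parallel arcs
  whose arc set is symmetric. An edge \<open>{u, v}\<close> is the pair of arcs \<open>(u, v)\<close>, \<open>(v, u)\<close>.
  Since arcs are symmetric, the components of the graph are its strongly connected components
  \<open>pre_digraph.sccs\<close> (the maximal connected induced subgraphs, necessarily nonempty).
\<close>

definition independent_set :: "('a, 'b) pre_digraph \<Rightarrow> 'a set \<Rightarrow> bool" where
  "independent_set G S \<longleftrightarrow> S \<subseteq> verts G \<and> (\<forall>u\<in>S. \<forall>v\<in>S. \<not> u \<rightarrow>\<^bsub>G\<^esub> v)"

definition independent_transversal ::
  "('a, 'b) pre_digraph \<Rightarrow> 'a set set \<Rightarrow> 'a set \<Rightarrow> bool" where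
  "independent_transversal G P T \<longleftrightarrow>
     independent_set G T \<and> (\<exists>v. (\<forall>V\<in>P. v V \<in> V) \<and> T = v ` P)"

definition has_IT :: "('a, 'b) pre_digraph \<Rightarrow> 'a set set \<Rightarrow> bool" where
  "has_IT G P \<longleftrightarrow> (\<exists>T. independent_transversal G P T)"

definition block_minimal_no_IT :: "('a, 'b) pre_digraph \<Rightarrow> 'a set set \<Rightarrow> bool" where
  "block_minimal_no_IT G P \<longleftrightarrow>
     \<not> has_IT G P \<and> (\<forall>V\<in>P. has_IT (G \<restriction> (verts G - V)) (P - {V}))"

definition bipartition_parts :: "'a set \<Rightarrow> 'a set \<Rightarrow> bool" where
  "bipartition_parts A B \<longleftrightarrow>
     finite A \<and> finite B \<and> A \<noteq> {} \<and> B \<noteq> {} \<and> A \<inter> B = {}"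

text \<open>\<open>complete_bipartite A B\<close> is $K_{A,B}$ only under \<open>bipartition_parts A B\<close>.\<close>

definition complete_bipartite :: "'a set \<Rightarrow> 'a set \<Rightarrow> 'a pair_pre_digraph" where
  "complete_bipartite A B = \<lparr>pverts = A \<union> B, parcs = A \<times> B \<union> B \<times> A\<rparr>"

definition pair_Union :: "'a pair_pre_digraph set \<Rightarrow> 'a pair_pre_digraph" where
  "pair_Union \<K> = \<lparr>pverts = (\<Union>K\<in>\<K>. pverts K), parcs = (\<Union>K\<in>\<K>. parcs K)\<rparr>"

definition disjoint_union_of_complete_bipartite :: "'a pair_pre_digraph \<Rightarrow> bool" where
  "disjoint_union_of_complete_bipartite G \<longleftrightarrow>
     (\<exists>\<K>. (\<forall>K\<in>\<K>. \<exists>A B. bipartition_parts A B \<and> K = complete_bipartite A B) \<and>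
          pairwise (\<lambda>K L. disjnt (pverts K) (pverts L)) \<K> \<and>
          G = pair_Union \<K>)"

text \<open>
  In the join step, \<open>X\<close> is the set of those vertices of the block \<open>W\<close> that are distributed
  into \<open>A\<close>; the remaining ones go into \<open>B\<close>. Either set may be empty.
\<close>

inductive join_constructible :: "'a pair_pre_digraph \<Rightarrow> 'a set set \<Rightarrow> bool" where
  start: "join_constructible (complete_bipartite A B) {A, B}"
    if "bipartition_parts A B"
| join: "join_constructible (pair_Union {H, complete_bipartite A B})
           ((Q - {W}) \<union> {A \<union> X, B \<union> (W - X)})"
    if "join_constructible H Q" and "W \<in> Q"
      and "bipartition_parts A B" and "disjnt (A \<union> B) (pverts H)"
      and "X \<subseteq> W"

end

theory Submission
  imports Defs
begin

text \<open>
  Regard every component \<open>K\<^sub>A\<^sub>,\<^sub>B\<close> as a Boolean variable and every block as the clause whose literals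
  are the sides of components that it meets. Choosing one side of every component shows that an
  independent transversal is the same as a satisfying assignment, so a block-minimal graph without
  one is a minimally unsatisfiable formula; here it has one more clause than variables.
  Saturate such a formula by adding literals as long as it stays unsatisfiable, and let \<open>v\<close> be a
  variable occurring in the fewest clauses. Then each restriction \<open>v := b\<close> is again minimally
  unsatisfiable and still contains all other variables, so by induction it has more clauses than
  variables. Hence each literal of \<open>v\<close> occurs in just one clause, i.e. each side of some component
  lies within a single block, and the last join step can be undone at this component.
\<close>

section \<open>Minimally unsatisfiable formulas\<close>

text \<open>A triple \<open>(i, x, b)\<close> says that clause \<open>i\<close> contains the literal that is true when \<open>x\<close> has value \<open>b\<close>.\<close>

definition satisfiable :: "'i set \<Rightarrow> ('i \<times> 'x \<times> bool) set \<Rightarrow> bool" where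
  "satisfiable I L \<longleftrightarrow> (\<exists>s. \<forall>i\<in>I. \<exists>x. (i, x, s x) \<in> L)"

definition minimal_unsat :: "'i set \<Rightarrow> ('i \<times> 'x \<times> bool) set \<Rightarrow> bool" where
  "minimal_unsat I L \<longleftrightarrow> \<not> satisfiable I L \<and> (\<forall>i\<in>I. satisfiable (I - {i}) L)"

lemma satisfiable_mono:
  assumes "satisfiable I L" "J \<subseteq> I" "L \<subseteq> M"
  shows "satisfiable J M"
proof -
  obtain s where "\<And>i. i \<in> I \<Longrightarrow> \<exists>x. (i, x, s x) \<in> L"
    using assms(1) unfolding satisfiable_def by blast
  then have "\<forall>i\<in>J. \<exists>x. (i, x, s x) \<in> M"
    using assms(2,3) by (meson subsetD)
  then show ?thesis unfolding satisfiable_def by blast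
qed

text \<open>A clause containing both literals of \<open>x\<close> holds under every assignment, so
  an assignment satisfying the other clauses would satisfy all of \<open>I\<close>.\<close>

lemma minimal_unsat_not_tautology:
  assumes mu: "minimal_unsat I L" and i: "i \<in> I" and "(i, x, b) \<in> L"
  shows "(i, x, \<not> b) \<notin> L"
proof
  assume "(i, x, \<not> b) \<in> L"
  then have *: "(i, x, c) \<in> L" for c
    using assms(3) by (cases c; cases b) auto
  from mu i obtain s where "\<forall>j\<in>I - {i}. \<exists>y. (j, y, s y) \<in> L"
    unfolding minimal_unsat_def satisfiable_def by blast
  with * have "\<forall>j\<in>I. \<exists>y. (j, y, s y) \<in> L"
    by blast
  with mu show False
    unfolding minimal_unsat_def satisfiable_def by blast
qed

text \<open>A pure literal can be made true for free: take an assignment for the clauses other than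
  \<open>i\<close> and set \<open>x\<close> to \<open>c\<close>. No clause relied on the opposite
  value.\<close>

lemma minimal_unsat_both_polarities:
  assumes mu: "minimal_unsat I L" and i: "i \<in> I" and L: "(i, x, c) \<in> L"
  shows "\<exists>j\<in>I. (j, x, b) \<in> L"
proof (rule ccontr)
  assume no: "\<not> (\<exists>j\<in>I. (j, x, b) \<in> L)"
  with i L have b: "b = (\<not> c)"
    by (cases b; cases c) auto
  from mu i obtain s where s: "\<forall>j\<in>I - {i}. \<exists>y. (j, y, s y) \<in> L"
    unfolding minimal_unsat_def satisfiable_def by blast
  have "\<exists>y. (j, y, (s(x := c)) y) \<in> L" if "j \<in> I" for j
  proof (cases "j = i")
    case True
    then show ?thesis using L by (intro exI[of _ x]) auto
  next
    case False
    with s that obtain y where y: "(j, y, s y) \<in> L" by blast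
    have "y = x \<Longrightarrow> s y = c"
      using y no that b by (cases "s y"; cases c) auto
    with y show ?thesis by (intro exI[of _ y]) auto
  qed
  then have "satisfiable I L"
    unfolding satisfiable_def by blast
  with mu show False
    unfolding minimal_unsat_def by blast
qed

text \<open>Among the finitely many unsatisfiable literal sets over \<open>I\<close> and
  \<open>X\<close>, choose a maximal one above \<open>L\<close>. Minimality survives, since extra
  literals only make the clause sets \<open>I - {i}\<close> easier to satisfy.\<close>

lemma minimal_unsat_saturate:
  assumes "finite I" "finite X" "L \<subseteq> I \<times> X \<times> UNIV" "minimal_unsat I L"
  obtains M where "L \<subseteq> M" "M \<subseteq> I \<times> X \<times> UNIV" "minimal_unsat I M"
    "\<And>i x b. i \<in> I \<Longrightarrow> x \<in> X \<Longrightarrow> (i, x, b) \<notin> M \<Longrightarrow> satisfiable I (insert (i, x, b) M)"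
proof -
  define C where "C = {M. M \<subseteq> I \<times> X \<times> (UNIV :: bool set) \<and> \<not> satisfiable I M}"
  have fin: "finite C"
    by (rule finite_subset[of _ "Pow (I \<times> X \<times> UNIV)"]) (use assms(1,2) C_def in auto)
  have "L \<in> C"
    using assms(3,4) unfolding minimal_unsat_def C_def by blast
  from finite_has_maximal2[OF fin this] obtain M
    where M: "M \<in> C" "L \<subseteq> M" and max: "\<forall>N\<in>C. M \<subseteq> N \<longrightarrow> M = N"
    by metis
  have M_C: "M \<subseteq> I \<times> X \<times> UNIV" "\<not> satisfiable I M"
    using M(1) unfolding C_def by auto
  show thesis
  proof (rule that)
    show "minimal_unsat I M"
      unfolding minimal_unsat_def
    proof (intro conjI ballI)
      show "satisfiable (I - {i}) M" if "i \<in> I" for i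
        using assms(4) that M(2) unfolding minimal_unsat_def by (meson satisfiable_mono order_refl)
    qed (fact M_C(2))
    show "satisfiable I (insert (i, x, b) M)" if "i \<in> I" "x \<in> X" "(i, x, b) \<notin> M" for i x b
    proof (rule ccontr)
      assume "\<not> ?thesis"
      with M_C(1) that(1,2) have "insert (i, x, b) M \<in> C"
        unfolding C_def by simp
      with max have "M = insert (i, x, b) M"
        by (meson subset_insertI)
      with that(3) show False by blast
    qed
  qed (fact M(2), fact M_C(1))
qed

section \<open>Fixing the value of one variable\<close>

definition remaining_clauses :: "'i set \<Rightarrow> ('i \<times> 'x \<times> bool) set \<Rightarrow> 'x \<Rightarrow> bool \<Rightarrow> 'i set" where
  "remaining_clauses I L v b = {i \<in> I. (i, v, b) \<notin> L}"

text \<open>Setting \<open>v := b\<close> deletes the clauses it satisfies and the falsified literal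
  of \<open>v\<close> from the others. Literals of deleted clauses are dropped too, so an occurrence
  here is always one in a surviving clause.\<close>

definition remaining_literals ::
    "('i \<times> 'x \<times> bool) set \<Rightarrow> 'x \<Rightarrow> bool \<Rightarrow> ('i \<times> 'x \<times> bool) set" where
  "remaining_literals L v b = {(i, x, c) \<in> L. x \<noteq> v \<and> (i, v, b) \<notin> L}"

text \<open>Saturation is what preserves minimality: in general, all assignments that satisfy
  everything but clause \<open>i\<close> might give \<open>v\<close> the wrong value. Adding the
  literal \<open>(i, v, b)\<close> yields an assignment with the right one.\<close>

lemma minimal_unsat_restrict:
  assumes mu: "minimal_unsat I L" and v: "v \<in> X"
    and sat: "\<And>i x b. i \<in> I \<Longrightarrow> x \<in> X \<Longrightarrow> (i, x, b) \<notin> L \<Longrightarrow> satisfiable I (insert (i, x, b) L)"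
  shows "minimal_unsat (remaining_clauses I L v b) (remaining_literals L v b)"
    (is "minimal_unsat ?J ?M")
  unfolding minimal_unsat_def
proof (intro conjI ballI)
  have unsat: "\<not> (\<forall>i\<in>I. \<exists>x. (i, x, s x) \<in> L)" for s
    using mu unfolding minimal_unsat_def satisfiable_def by blast
  show "\<not> satisfiable ?J ?M"
  proof
    assume "satisfiable ?J ?M"
    then obtain s where s: "\<forall>i\<in>?J. \<exists>x. (i, x, s x) \<in> ?M"
      unfolding satisfiable_def by blast
    have "\<exists>x. (i, x, (s(v := b)) x) \<in> L" if "i \<in> I" for i
    proof (cases "(i, v, b) \<in> L")
      case True
      then show ?thesis by (intro exI[of _ v]) auto
    next
      case False
      with that s obtain x where "(i, x, s x) \<in> ?M"
        unfolding remaining_clauses_def by blast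
      then show ?thesis
        unfolding remaining_literals_def by (intro exI[of _ x]) auto
    qed
    with unsat show False by blast
  qed
  fix i assume "i \<in> ?J"
  then have i: "i \<in> I" "(i, v, b) \<notin> L"
    unfolding remaining_clauses_def by auto
  from sat[OF i(1) v i(2)] obtain s where s: "\<forall>j\<in>I. \<exists>x. (j, x, s x) \<in> insert (i, v, b) L"
    unfolding satisfiable_def by blast
  \<comment> \<open>Otherwise the added literal is false under \<open>s\<close>, and
    \<open>s\<close> would already satisfy the original formula.\<close>
  have sv: "s v = b"
  proof (rule ccontr)
    assume "s v \<noteq> b"
    with s have "\<forall>j\<in>I. \<exists>x. (j, x, s x) \<in> L" by blast
    with unsat show False by blast
  qed
  have "\<exists>x. (j, x, s x) \<in> ?M" if "j \<in> ?J - {i}" for j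
    using s sv that unfolding remaining_clauses_def remaining_literals_def by fastforce
  then show "satisfiable (?J - {i}) ?M"
    unfolding satisfiable_def by blast
qed

text \<open>Choosing \<open>v\<close> with the fewest occurrences after saturation keeps every other
  variable alive in both restrictions, which is what an induction on the number of variables
  needs.\<close>

lemma minimal_unsat_split:
  assumes fin: "finite I" "finite X" and L: "L \<subseteq> I \<times> X \<times> UNIV" and mu: "minimal_unsat I L"
    and occ: "\<forall>x\<in>X. \<exists>i c. (i, x, c) \<in> L" and "X \<noteq> {}"
  obtains M v where "L \<subseteq> M" "v \<in> X"
    "\<And>b. \<exists>i\<in>I. (i, v, b) \<in> M"
    "\<And>b. minimal_unsat (remaining_clauses I M v b) (remaining_literals M v b)"
    "\<And>b. remaining_literals M v b \<subseteq> remaining_clauses I M v b \<times> (X - {v}) \<times> UNIV"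
    "\<And>b. \<forall>x\<in>X - {v}. \<exists>i c. (i, x, c) \<in> remaining_literals M v b"
proof -
  obtain M where M: "L \<subseteq> M" "M \<subseteq> I \<times> X \<times> UNIV" "minimal_unsat I M"
    and sat: "\<And>i x b. i \<in> I \<Longrightarrow> x \<in> X \<Longrightarrow> (i, x, b) \<notin> M \<Longrightarrow> satisfiable I (insert (i, x, b) M)"
    using minimal_unsat_saturate[OF fin L mu] by metis
  define deg where "deg x = card {i. \<exists>c. (i, x, c) \<in> M}" for x
  have fin_occ: "finite {i. \<exists>c. (i, x, c) \<in> M}" for x
    by (rule finite_subset[OF _ fin(1)]) (use M(2) in auto)
  obtain v where v: "v \<in> X" and min: "\<And>x. x \<in> X \<Longrightarrow> deg v \<le> deg x"
    using \<open>X \<noteq> {}\<close> fin(2) by (metis arg_min_least arg_min_if_finite(1))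
  have both: "\<exists>i\<in>I. (i, v, b) \<in> M" for b
  proof -
    obtain i c where "(i, v, c) \<in> M" using occ v M(1) by blast
    then show ?thesis
      using minimal_unsat_both_polarities[OF M(3)] M(2) by blast
  qed
  have "\<exists>i c. (i, x, c) \<in> remaining_literals M v b" if x: "x \<in> X - {v}" for x b
  proof (rule ccontr)
    assume "\<nexists>i c. (i, x, c) \<in> remaining_literals M v b"
    \<comment> \<open>If \<open>x\<close> disappears, every clause with \<open>x\<close> contains
      \<open>(v, b)\<close>. A clause with the opposite literal of \<open>v\<close> then lacks
      \<open>x\<close>, so \<open>x\<close> would occur in strictly fewer clauses than
      \<open>v\<close>.\<close>
    with x have sub: "{i. \<exists>c. (i, x, c) \<in> M} \<subseteq> {i. (i, v, b) \<in> M}"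
      unfolding remaining_literals_def by blast
    obtain j where j: "j \<in> I" "(j, v, \<not> b) \<in> M" using both by blast
    then have "(j, v, b) \<notin> M"
      using minimal_unsat_not_tautology[OF M(3)] by fastforce
    with j sub have "{i. \<exists>c. (i, x, c) \<in> M} \<subset> {i. \<exists>c. (i, v, c) \<in> M}" by blast
    then have "deg x < deg v"
      unfolding deg_def by (rule psubset_card_mono[OF fin_occ])
    with min x show False by fastforce
  qed
  moreover have "remaining_literals M v b \<subseteq> remaining_clauses I M v b \<times> (X - {v}) \<times> UNIV" for b
    using M(2) unfolding remaining_clauses_def remaining_literals_def by auto
  ultimately show thesis
    using that[OF M(1) v both] minimal_unsat_restrict[OF M(3) v sat] by blast
qed

section \<open>Comparing the numbers of clauses and variables\<close>

lemma card_remaining_clauses: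
  assumes "finite I"
  shows "card (remaining_clauses I L v b) + card {i \<in> I. (i, v, b) \<in> L} = card I"
proof -
  have "card (remaining_clauses I L v b \<union> {i \<in> I. (i, v, b) \<in> L})
      = card (remaining_clauses I L v b) + card {i \<in> I. (i, v, b) \<in> L}"
    by (rule card_Un_disjoint) (use assms in \<open>auto simp: remaining_clauses_def\<close>)
  moreover have "remaining_clauses I L v b \<union> {i \<in> I. (i, v, b) \<in> L} = I"
    unfolding remaining_clauses_def by auto
  ultimately show ?thesis by simp
qed

text \<open>This is Tarsi's lemma, by induction on the number of variables: the restriction
  \<open>v := True\<close> loses one variable and at least one clause. In the base case a clause
  exists because the empty formula is satisfiable.\<close>

lemma minimal_unsat_card:
  assumes "finite I" "finite X" "L \<subseteq> I \<times> X \<times> UNIV" "minimal_unsat I L"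
    and "\<forall>x\<in>X. \<exists>i c. (i, x, c) \<in> L"
  shows "card X < card I"
  using assms
proof (induction "card X" arbitrary: I X L)
  case 0
  then have "I \<noteq> {}"
    unfolding minimal_unsat_def satisfiable_def by blast
  with 0 show ?case
    by (simp add: card_gt_0_iff)
next
  case (Suc n)
  then have "X \<noteq> {}" by auto
  from minimal_unsat_split[OF Suc.prems this] obtain M v where
    v: "v \<in> X" "\<exists>i\<in>I. (i, v, True) \<in> M"
    and mu: "minimal_unsat (remaining_clauses I M v True) (remaining_literals M v True)"
      "remaining_literals M v True \<subseteq> remaining_clauses I M v True \<times> (X - {v}) \<times> UNIV"
      "\<forall>x\<in>X - {v}. \<exists>i c. (i, x, c) \<in> remaining_literals M v True"
    by metis
  have n: "n = card (X - {v})"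
    using Suc v by simp
  have "finite (remaining_clauses I M v True)" "finite (X - {v})"
    using Suc.prems unfolding remaining_clauses_def by auto
  from Suc.hyps(1)[OF n this mu(2,1,3)] have "n < card (remaining_clauses I M v True)"
    using n by simp
  moreover have "card {i \<in> I. (i, v, True) \<in> M} > 0"
    using v(2) Suc.prems(1) by (auto simp: card_gt_0_iff)
  ultimately show ?case
    using card_remaining_clauses[OF Suc.prems(1), of M v True] Suc.hyps(2) by linarith
qed

text \<open>By the previous bound, at least \<open>card X\<close> clauses survive each restriction
  of the saturated formula; the deleted ones are those containing the literal. With one more clause
  than variables this leaves one occurrence per literal.\<close>

lemma minimal_unsat_few_occurrences:
  assumes fin: "finite I" "finite X" and L: "L \<subseteq> I \<times> X \<times> UNIV" "minimal_unsat I L"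
    and occ: "\<forall>x\<in>X. \<exists>i c. (i, x, c) \<in> L" and X: "X \<noteq> {}"
  shows "\<exists>v\<in>X. \<forall>b. card {i \<in> I. (i, v, b) \<in> L} + card X \<le> card I"
proof -
  from minimal_unsat_split[OF fin L occ X] obtain M v where
    M: "L \<subseteq> M" and v: "v \<in> X"
    and mu: "\<And>b. minimal_unsat (remaining_clauses I M v b) (remaining_literals M v b)"
      "\<And>b. remaining_literals M v b \<subseteq> remaining_clauses I M v b \<times> (X - {v}) \<times> UNIV"
      "\<And>b. \<forall>x\<in>X - {v}. \<exists>i c. (i, x, c) \<in> remaining_literals M v b"
    by metis
  have "card {i \<in> I. (i, v, b) \<in> L} + card X \<le> card I" for b
  proof -
    have "finite (remaining_clauses I M v b)" "finite (X - {v})"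
      using fin unfolding remaining_clauses_def by auto
    from minimal_unsat_card[OF this mu(2,1,3)]
    have "card (X - {v}) < card (remaining_clauses I M v b)" .
    moreover have "card X = Suc (card (X - {v}))"
      using fin(2) v by (rule card.remove)
    \<comment> \<open>Saturation only adds occurrences, so the bound for \<open>M\<close> passes to
      \<open>L\<close>.\<close>
    moreover have "card {i \<in> I. (i, v, b) \<in> L} \<le> card {i \<in> I. (i, v, b) \<in> M}"
      by (rule card_mono) (use fin(1) M in auto)
    ultimately show ?thesis
      using card_remaining_clauses[OF fin(1), of M v b] by linarith
  qed
  with v show ?thesis by blast
qed

section \<open>Transversals as choice functions\<close>

text \<open>Only an arc set and a family of blocks enter, without a host graph: deleting a block
  then changes \<open>P\<close> alone and no induced subgraph is needed.\<close>

definition has_choice :: "('a \<times> 'a) set \<Rightarrow> 'a set set \<Rightarrow> bool" where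
  "has_choice E P \<longleftrightarrow> (\<exists>v. (\<forall>V\<in>P. v V \<in> V) \<and> (\<forall>U\<in>P. \<forall>V\<in>P. (v U, v V) \<notin> E))"

definition minimal_no_choice :: "('a \<times> 'a) set \<Rightarrow> 'a set set \<Rightarrow> bool" where
  "minimal_no_choice E P \<longleftrightarrow> \<not> has_choice E P \<and> (\<forall>V\<in>P. has_choice E (P - {V}))"

lemma has_choiceI:
  assumes "\<And>V. V \<in> P \<Longrightarrow> v V \<in> V" "\<And>U V. U \<in> P \<Longrightarrow> V \<in> P \<Longrightarrow> (v U, v V) \<notin> E"
  shows "has_choice E P"
  unfolding has_choice_def by (rule exI[of _ v]) (simp add: assms)

lemma has_choiceE:
  assumes "has_choice E P"
  obtains v where "\<And>V. V \<in> P \<Longrightarrow> v V \<in> V" "\<And>U V. U \<in> P \<Longrightarrow> V \<in> P \<Longrightarrow> (v U, v V) \<notin> E"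
proof -
  from assms obtain v where "(\<forall>V\<in>P. v V \<in> V) \<and> (\<forall>U\<in>P. \<forall>V\<in>P. (v U, v V) \<notin> E)"
    unfolding has_choice_def ..
  then show thesis
    using that[of v] by simp
qed

lemma has_choice_mono:
  assumes "has_choice E P" "Q \<subseteq> P" "D \<subseteq> E"
  shows "has_choice D Q"
  using assms(1)
proof (rule has_choiceE)
  fix v assume v: "\<And>V. V \<in> P \<Longrightarrow> v V \<in> V" "\<And>U V. U \<in> P \<Longrightarrow> V \<in> P \<Longrightarrow> (v U, v V) \<notin> E"
  show ?thesis
  proof (rule has_choiceI)
    show "v V \<in> V" if "V \<in> Q" for V
      using v(1) that assms(2) by (meson subsetD)
    show "(v U, v V) \<notin> D" if "U \<in> Q" "V \<in> Q" for U V
      using v(2) that assms(2,3) by (meson subsetD)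
  qed
qed

lemma has_IT_iff_choice:
  "has_IT G Q \<longleftrightarrow> (\<exists>v. (\<forall>V\<in>Q. v V \<in> V) \<and> independent_set G (v ` Q))"
  unfolding has_IT_def independent_transversal_def by blast

text \<open>\<open>E\<close> has to agree with the arcs only on the vertices of \<open>G\<close>, so
  one arc set serves for the whole graph and for its induced subgraphs.\<close>

lemma has_IT_iff_has_choice:
  assumes "\<Union> Q \<subseteq> verts G" "\<And>u v. u \<in> verts G \<Longrightarrow> v \<in> verts G \<Longrightarrow> u \<rightarrow>\<^bsub>G\<^esub> v \<longleftrightarrow> (u, v) \<in> E"
  shows "has_IT G Q \<longleftrightarrow> has_choice E Q"
proof -
  have "independent_set G (v ` Q) \<longleftrightarrow> (\<forall>U\<in>Q. \<forall>V\<in>Q. (v U, v V) \<notin> E)"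
    if "\<forall>V\<in>Q. v V \<in> V" for v
  proof -
    have "v V \<in> verts G" if "V \<in> Q" for V
      using that \<open>\<forall>V\<in>Q. v V \<in> V\<close> assms(1) by blast
    then show ?thesis
      using assms(2) by (simp add: independent_set_def image_subset_iff)
  qed
  then show ?thesis
    unfolding has_IT_iff_choice has_choice_def by blast
qed

lemma arcs_ends_induce_with_proj:
  "u \<rightarrow>\<^bsub>with_proj G \<restriction> S\<^esub> v \<longleftrightarrow> (u, v) \<in> parcs G \<and> u \<in> S \<and> v \<in> S"
  by (auto simp: induce_subgraph_def arcs_ends_def arc_to_ends_def with_proj_def image_iff)

lemma block_minimal_no_IT_imp_minimal_no_choice:
  assumes "partition_on (pverts G) P" "block_minimal_no_IT (with_proj G) P"
  shows "minimal_no_choice (parcs G) P"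
  unfolding minimal_no_choice_def
proof (intro conjI ballI)
  have P: "\<Union> P = pverts G" "disjoint P"
    using assms(1) by (auto simp: partition_on_def)
  show "\<not> has_choice (parcs G) P"
    using assms(2) has_IT_iff_has_choice[of P "with_proj G" "parcs G"] P(1)
    unfolding block_minimal_no_IT_def by simp
  fix V assume V: "V \<in> P"
  have "\<Union> (P - {V}) \<subseteq> pverts G - V"
    using P V by (fastforce simp: disjoint_def)
  then show "has_choice (parcs G) (P - {V})"
    using assms(2) V
      has_IT_iff_has_choice[of "P - {V}" "with_proj G \<restriction> (pverts G - V)" "parcs G"]
    unfolding block_minimal_no_IT_def by (simp add: arcs_ends_induce_with_proj)
qed

text \<open>A choice from \<open>W\<close> extends to \<open>V1\<close> and \<open>V2\<close>: the
  chosen vertex lies in one of them, and the other takes a vertex of \<open>A\<close> or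
  \<open>B\<close>. Conversely, a choice from both \<open>V1\<close> and \<open>V2\<close> must hit
  \<open>W\<close>, as \<open>A\<close> and \<open>B\<close> are completely joined.\<close>

lemma minimal_no_choice_undo_join:
  assumes min: "minimal_no_choice (D \<union> parcs (complete_bipartite A B)) P"
    and AB: "bipartition_parts A B"
    and D: "D \<subseteq> (- (A \<union> B)) \<times> (- (A \<union> B))"
    and P: "disjoint P" "{} \<notin> P" "V1 \<in> P" "V2 \<in> P" "V1 \<noteq> V2" "A \<subseteq> V1" "B \<subseteq> V2"
    and W: "W = (V1 \<union> V2) - (A \<union> B)" "W \<noteq> {}"
  shows "minimal_no_choice D (insert W (P - {V1, V2}))"
  unfolding minimal_no_choice_def
proof (intro conjI ballI notI)
  let ?E = "D \<union> parcs (complete_bipartite A B)" and ?Q = "insert W (P - {V1, V2})"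
  have E: "?E = D \<union> A \<times> B \<union> B \<times> A"
    by (auto simp: complete_bipartite_def)
  have ne: "A \<noteq> {}" "B \<noteq> {}" and AB_disj: "A \<inter> B = {}"
    using AB by (auto simp: bipartition_parts_def)
  have disj: "U \<inter> V = {}" if "U \<in> P" "V \<in> P" "U \<noteq> V" for U V
    using P(1) that by (auto simp: disjoint_def)
  have W_notin: "W \<notin> P - {V1, V2}"
    using disj P(3,4) W by blast
  {
    assume "has_choice D ?Q"
    then obtain v where v: "\<And>V. V \<in> ?Q \<Longrightarrow> v V \<in> V"
      "\<And>U V. U \<in> ?Q \<Longrightarrow> V \<in> ?Q \<Longrightarrow> (v U, v V) \<notin> D"
      by (rule has_choiceE) iprover
    have "v W \<in> W" by (rule v(1)) simp
    moreover obtain a b where "a \<in> A" "b \<in> B" using ne by blast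
    \<comment> \<open>If \<open>v W\<close> lies in \<open>V1\<close>, then \<open>c\<close> is the
      vertex \<open>b\<close> for \<open>V2\<close>; otherwise \<open>c\<close> is the vertex
      \<open>a\<close> for \<open>V1\<close>.\<close>
    ultimately obtain a1 a2 c where a: "a1 \<in> V1" "a2 \<in> V2"
      and c: "c \<in> A \<union> B" "a1 \<in> {c, v W}" "a2 \<in> {c, v W}"
      using W(1) P(6,7) by blast
    define u where "u V = (if V = V1 then a1 else if V = V2 then a2 else v V)" for V
    have vAB: "v V \<notin> A \<union> B" if "V \<in> ?Q" for V
    proof (cases "V = W")
      case True
      with v(1)[OF that] W(1) show ?thesis by blast
    next
      case False
      with that have "V \<inter> V1 = {}" "V \<inter> V2 = {}"
        using disj P(3,4) by simp_all
      with v(1)[OF that] P(6,7) show ?thesis by blast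
    qed
    have u: "u V \<in> insert c (v ` ?Q)" if "V \<in> P" for V
      using c(2,3) that by (auto simp: u_def)
    \<comment> \<open>Arcs of \<open>D\<close> avoid \<open>c\<close>, and \<open>c\<close> is the
      only vertex of \<open>A \<union> B\<close> in this set, so an arc between \<open>A\<close> and
      \<open>B\<close> would have to be a loop at \<open>c\<close>.\<close>
    have no_edge: "(x, y) \<notin> ?E" if xy: "x \<in> insert c (v ` ?Q)" "y \<in> insert c (v ` ?Q)" for x y
    proof
      assume "(x, y) \<in> ?E"
      then consider "(x, y) \<in> D" | "(x, y) \<in> A \<times> B \<union> B \<times> A" unfolding E by blast
      then show False
      proof cases
        case 1
        with D c(1) have "x \<noteq> c" "y \<noteq> c" by auto
        with xy obtain X Y where "X \<in> ?Q" "x = v X" "Y \<in> ?Q" "y = v Y" by blast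
        with 1 v(2) show False by metis
      next
        case 2
        have *: "z = c" if "z \<in> insert c (v ` ?Q)" "z \<in> A \<union> B" for z
          using vAB that by blast
        from 2 have "x \<in> A \<union> B" "y \<in> A \<union> B" by blast+
        from *[OF xy(1) this(1)] *[OF xy(2) this(2)] have "x = c" "y = c" .
        with 2 AB_disj show False by blast
      qed
    qed
    have "has_choice ?E P"
    proof (rule has_choiceI)
      show "u V \<in> V" if "V \<in> P" for V
        using that a v(1)[of V] by (simp add: u_def)
      show "(u U, u V) \<notin> ?E" if "U \<in> P" "V \<in> P" for U V
        using no_edge[OF u[OF that(1)] u[OF that(2)]] .
    qed
    with min show False
      unfolding minimal_no_choice_def by blast
  }
  fix U assume U: "U \<in> ?Q"
  show "has_choice D (?Q - {U})"
  proof (cases "U = W")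
    case True
    then have "?Q - {U} \<subseteq> P - {V1}"
      by blast
    then show ?thesis
      using min P(3) unfolding minimal_no_choice_def by (blast intro: has_choice_mono)
  next
    case False
    with U min have "has_choice ?E (P - {U})"
      unfolding minimal_no_choice_def by blast
    then obtain v where v: "\<And>V. V \<in> P - {U} \<Longrightarrow> v V \<in> V"
      "\<And>V V'. V \<in> P - {U} \<Longrightarrow> V' \<in> P - {U} \<Longrightarrow> (v V, v V') \<notin> ?E"
      by (rule has_choiceE) iprover
    have "\<exists>V\<in>{V1, V2}. v V \<in> W"
    proof (rule ccontr)
      assume no: "\<not> ?thesis"
      have V: "V1 \<in> P - {U}" "V2 \<in> P - {U}" using U False P(3,4) by auto
      have "v V1 \<in> A" "v V2 \<in> B"
        using no v(1)[OF V(1)] v(1)[OF V(2)] W(1) disj[OF P(3,4,5)] P(6,7) by blast+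
      with v(2)[OF V] show False unfolding E by blast
    qed
    then obtain V0 where V0: "V0 \<in> {V1, V2}" "v V0 \<in> W" by blast
    \<comment> \<open>The merged block inherits the vertex chosen in \<open>V0\<close>; all other
      blocks keep theirs, so no new pair of chosen vertices arises.\<close>
    define u where "u = v(W := v V0)"
    have uW: "u W = v V0" and uV: "\<And>V. V \<in> P - {V1, V2} \<Longrightarrow> u V = v V"
      using W_notin by (auto simp: u_def)
    have u: "\<exists>V'\<in>P - {U}. u V = v V'" if "V \<in> ?Q - {U}" for V
    proof (cases "V = W")
      case True
      have "V0 \<in> P - {U}" using V0(1) U False P(3,4) by auto
      with True uW show ?thesis by blast
    next
      case False
      with that have V: "V \<in> P - {V1, V2}" "V \<in> P - {U}" by blast+
      with uV[OF V(1)] show ?thesis by blast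
    qed
    show ?thesis
    proof (rule has_choiceI)
      show "u V \<in> V" if "V \<in> ?Q - {U}" for V
      proof (cases "V = W")
        case True
        then show ?thesis using uW V0(2) by simp
      next
        case False
        with that have V: "V \<in> P - {V1, V2}" "V \<in> P - {U}" by blast+
        then show ?thesis using uV[OF V(1)] v(1)[OF V(2)] by simp
      qed
      show "(u V, u V') \<notin> D" if "V \<in> ?Q - {U}" "V' \<in> ?Q - {U}" for V V'
      proof -
        from u[OF that(1)] u[OF that(2)] obtain X Y
          where "X \<in> P - {U}" "u V = v X" "Y \<in> P - {U}" "u V' = v Y" by metis
        with v(2)[of X Y] show ?thesis by (metis UnI1)
      qed
    qed
  qed
qed

section \<open>Disjoint unions of complete bipartite graphs\<close>

lemma complete_bipartite_sel [simp]:
  "pverts (complete_bipartite A B) = A \<union> B"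
  "parcs (complete_bipartite A B) = A \<times> B \<union> B \<times> A"
  by (simp_all add: complete_bipartite_def)

lemma pair_Union_sel [simp]:
  "pverts (pair_Union \<K>) = (\<Union>K\<in>\<K>. pverts K)"
  "parcs (pair_Union \<K>) = (\<Union>K\<in>\<K>. parcs K)"
  by (simp_all add: pair_Union_def)

text \<open>Indexing the sides by truth values makes \<open>S K b\<close> the literal
  "\<open>K\<close> has value \<open>b\<close>", with \<open>S K (\<not> b)\<close> as its
  negation.\<close>

locale bipartite_family =
  fixes \<K> :: "'a pair_pre_digraph set" and S :: "'a pair_pre_digraph \<Rightarrow> bool \<Rightarrow> 'a set"
  assumes parts: "\<And>K. K \<in> \<K> \<Longrightarrow> bipartition_parts (S K True) (S K False)"
    and K_eq: "\<And>K. K \<in> \<K> \<Longrightarrow> K = complete_bipartite (S K True) (S K False)"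
    and disj: "pairwise (\<lambda>K L. disjnt (pverts K) (pverts L)) \<K>"
begin

lemma pverts_eq: "K \<in> \<K> \<Longrightarrow> pverts K = (\<Union>b. S K b)"
  using K_eq[of K] by (metis UNIV_bool Un_commute UN_insert UN_empty Un_empty_right
      complete_bipartite_sel(1))

lemma parcs_iff: "K \<in> \<K> \<Longrightarrow> (x, y) \<in> parcs K \<longleftrightarrow> (\<exists>b. x \<in> S K b \<and> y \<in> S K (\<not> b))"
proof -
  assume "K \<in> \<K>"
  then have "parcs K = S K True \<times> S K False \<union> S K False \<times> S K True"
    using K_eq complete_bipartite_sel(2) by metis
  then show ?thesis
    by (auto simp: ex_bool_eq)
qed

lemma same_component:
  "K \<in> \<K> \<Longrightarrow> L \<in> \<K> \<Longrightarrow> x \<in> S K b \<Longrightarrow> x \<in> S L c \<Longrightarrow> K = L \<and> b = c"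
proof -
  assume KL: "K \<in> \<K>" "L \<in> \<K>" and x: "x \<in> S K b" "x \<in> S L c"
  then have "x \<in> pverts K" "x \<in> pverts L"
    using pverts_eq by auto
  with disj KL have "K = L"
    by (auto simp: pairwise_def disjnt_def)
  with parts[OF KL(1)] x show ?thesis
    by (cases b; cases c) (auto simp: bipartition_parts_def)
qed

lemma S_nonempty: "K \<in> \<K> \<Longrightarrow> S K b \<noteq> {}"
  using parts by (cases b) (auto simp: bipartition_parts_def)

lemma subfamily: "\<L> \<subseteq> \<K> \<Longrightarrow> bipartite_family \<L> S"
  using parts K_eq disj by unfold_locales (auto intro: pairwise_subset)

section \<open>Blocks as clauses over the components\<close>

text \<open>Vertices of a block on the same side of a component give one literal; they have the same
  neighbours and are interchangeable in a transversal.\<close>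

definition literals :: "'a set set \<Rightarrow> ('a set \<times> 'a pair_pre_digraph \<times> bool) set" where
  "literals P = {(V, K, b). V \<in> P \<and> K \<in> \<K> \<and> V \<inter> S K b \<noteq> {}}"

text \<open>An independent choice never uses both sides of a component, so the sides it uses define
  an assignment; conversely, vertices on the sides selected by an assignment are independent. The
  literals come from all of \<open>P\<close>, so deleting a block only deletes a clause.\<close>

lemma has_choice_iff_satisfiable:
  assumes QP: "Q \<subseteq> P" and P: "\<Union> P \<subseteq> pverts (pair_Union \<K>)"
  shows "has_choice (parcs (pair_Union \<K>)) Q \<longleftrightarrow> satisfiable Q (literals P)"
proof
  assume "has_choice (parcs (pair_Union \<K>)) Q"
  then obtain v where v: "\<And>V. V \<in> Q \<Longrightarrow> v V \<in> V"
    "\<And>U V. U \<in> Q \<Longrightarrow> V \<in> Q \<Longrightarrow> (v U, v V) \<notin> parcs (pair_Union \<K>)"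
    by (rule has_choiceE) iprover
  \<comment> \<open>A component missed by the choice gets the harmless default
    \<open>False\<close>.\<close>
  define s where "s K \<longleftrightarrow> (\<exists>V\<in>Q. v V \<in> S K True)" for K
  have "\<exists>K. (V, K, s K) \<in> literals P" if V: "V \<in> Q" for V
  proof -
    have "v V \<in> pverts (pair_Union \<K>)"
      using v(1)[OF V] V QP P by blast
    then obtain K b where K: "K \<in> \<K>" "v V \<in> S K b"
      using pverts_eq by auto
    have "s K = b"
    proof (cases b)
      case True
      with K V show ?thesis by (auto simp: s_def)
    next
      case False
      have "\<not> s K"
      proof
        assume "s K"
        then obtain U where U: "U \<in> Q" "v U \<in> S K True"
          unfolding s_def by blast
        with K False have "(v U, v V) \<in> parcs K"
          using parcs_iff[OF K(1)] by (metis (full_types))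
        with v(2)[OF U(1) V] K(1) show False by auto
      qed
      with False show ?thesis by simp
    qed
    with K v(1)[OF V] V QP show ?thesis
      unfolding literals_def by blast
  qed
  then show "satisfiable Q (literals P)"
    unfolding satisfiable_def by blast
next
  assume "satisfiable Q (literals P)"
  then obtain s where "\<forall>V\<in>Q. \<exists>K. (V, K, s K) \<in> literals P"
    unfolding satisfiable_def by blast
  then have "\<forall>V\<in>Q. \<exists>x. x \<in> V \<and> (\<exists>K\<in>\<K>. x \<in> S K (s K))"
    unfolding literals_def by blast
  then obtain v where v: "\<And>V. V \<in> Q \<Longrightarrow> v V \<in> V" "\<And>V. V \<in> Q \<Longrightarrow> \<exists>K\<in>\<K>. v V \<in> S K (s K)"
    by metis
  have "(v U, v V) \<notin> parcs (pair_Union \<K>)" if "U \<in> Q" "V \<in> Q" for U V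
  proof
    assume "(v U, v V) \<in> parcs (pair_Union \<K>)"
    then obtain K b where K: "K \<in> \<K>" "v U \<in> S K b" "v V \<in> S K (\<not> b)"
      using parcs_iff by auto
    with v(2)[OF that(1)] v(2)[OF that(2)] have "s K = b" "s K = (\<not> b)"
      using same_component by metis+
    then show False by simp
  qed
  with v(1) show "has_choice (parcs (pair_Union \<K>)) Q"
    by (rule has_choiceI)
qed

lemma component_within_two_blocks:
  assumes fin: "finite \<K>" "\<K> \<noteq> {}"
    and P: "\<Union> P = pverts (pair_Union \<K>)" "finite P" "card P = Suc (card \<K>)"
    and min: "minimal_no_choice (parcs (pair_Union \<K>)) P"
  obtains K V1 V2 where "K \<in> \<K>" "V1 \<in> P" "V2 \<in> P" "V1 \<noteq> V2" "S K True \<subseteq> V1" "S K False \<subseteq> V2"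
proof -
  have mu: "minimal_unsat P (literals P)"
    using min has_choice_iff_satisfiable[OF _ equalityD1[OF P(1)]]
    unfolding minimal_no_choice_def minimal_unsat_def by auto
  have cover: "\<exists>V\<in>P. x \<in> V" if "K \<in> \<K>" "x \<in> S K b" for K x b
  proof -
    have "x \<in> \<Union> P" using that pverts_eq P(1) by auto
    then show ?thesis by blast
  qed
  have occ: "\<exists>V c. (V, K, c) \<in> literals P" if K: "K \<in> \<K>" for K
  proof -
    obtain x where x: "x \<in> S K True" using S_nonempty[OF K] by blast
    with cover[OF K] obtain V where "V \<in> P" "x \<in> V" by blast
    with x K have "(V, K, True) \<in> literals P" unfolding literals_def by auto
    then show ?thesis by blast
  qed
  have "literals P \<subseteq> P \<times> \<K> \<times> UNIV"
    unfolding literals_def by blast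
  \<comment> \<open>Since \<open>card P = Suc (card \<K>)\<close>, the general bound becomes at most
    one block per side of \<open>K\<close>.\<close>
  from minimal_unsat_few_occurrences[OF P(2) fin(1) this mu _ fin(2)] occ obtain K
    where K: "K \<in> \<K>" and few: "\<And>b. card {V \<in> P. (V, K, b) \<in> literals P} \<le> 1"
    using P(3) by fastforce
  have one_block: "\<exists>V\<in>P. S K b \<subseteq> V" for b
  proof -
    have eq: "U = V" if "U \<in> P" "V \<in> P" "U \<inter> S K b \<noteq> {}" "V \<inter> S K b \<noteq> {}" for U V
      using few[of b] that K P(2) unfolding literals_def
      by (auto simp: card_le_Suc0_iff_eq)
    obtain x where "x \<in> S K b" using S_nonempty[OF K] by blast
    with cover[OF K] obtain V where V: "V \<in> P" "V \<inter> S K b \<noteq> {}" by blast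
    have "y \<in> V" if y: "y \<in> S K b" for y
    proof -
      from cover[OF K y] obtain U where "U \<in> P" "y \<in> U" by blast
      with eq[of U V] V y show ?thesis by blast
    qed
    with V(1) show ?thesis by blast
  qed
  obtain V1 V2 where V: "V1 \<in> P" "V2 \<in> P" "S K True \<subseteq> V1" "S K False \<subseteq> V2"
    using one_block by metis
  \<comment> \<open>A block containing both sides would be a tautological clause.\<close>
  have "V1 \<noteq> V2"
  proof
    assume "V1 = V2"
    then have "V1 \<inter> S K b \<noteq> {}" for b
      using V(3,4) S_nonempty[OF K, of b] by (cases b) auto
    with V(1) K have "(V1, K, True) \<in> literals P" "(V1, K, \<not> True) \<in> literals P"
      unfolding literals_def by auto
    with minimal_unsat_not_tautology[OF mu V(1)] show False by blast
  qed
  from that[OF K V(1,2) this V(3,4)] show thesis .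
qed

end

text \<open>Induction on the number of components. Removing \<open>K\<close> and merging
  \<open>V1\<close> and \<open>V2\<close> into \<open>W\<close> lowers both the number of blocks and
  that of components by one, unless \<open>W\<close> is empty, which is the starting
  configuration.\<close>

lemma join_constructible_pair_Union:
  assumes "bipartite_family \<K> S" "finite \<K>" "\<K> \<noteq> {}"
    and "partition_on (pverts (pair_Union \<K>)) P" "finite P" "card P = Suc (card \<K>)"
    and "minimal_no_choice (parcs (pair_Union \<K>)) P"
  shows "join_constructible (pair_Union \<K>) P"
  using assms
proof (induction "card \<K>" arbitrary: \<K> P)
  case 0
  from 0(1) 0(3,4) show ?case by simp
next
  case (Suc n)
  interpret bipartite_family \<K> S by fact
  have P: "\<Union> P = pverts (pair_Union \<K>)" "disjoint P" "{} \<notin> P"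
    using Suc.prems(4) by (auto simp: partition_on_def)
  obtain K V1 V2 where K: "K \<in> \<K>" and V: "V1 \<in> P" "V2 \<in> P" "V1 \<noteq> V2"
      "S K True \<subseteq> V1" "S K False \<subseteq> V2"
    using component_within_two_blocks[OF Suc.prems(2,3) P(1) Suc.prems(5,6,7)] by metis
  define A B where "A = S K True" and "B = S K False"
  have AB: "bipartition_parts A B" "K = complete_bipartite A B" "A \<subseteq> V1" "B \<subseteq> V2"
    unfolding A_def B_def by (fact parts[OF K], fact K_eq[OF K], fact V(4), fact V(5))
  define \<H> where "\<H> = \<K> - {K}"
  define W where "W = (V1 \<union> V2) - (A \<union> B)"
  have KH: "\<K> = insert K \<H>" "K \<notin> \<H>" using K \<H>_def by auto
  interpret H: bipartite_family \<H> S
    using subfamily[of \<H>] \<H>_def by blast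
  have V12: "V1 \<inter> V2 = {}" using P(2) V by (auto simp: disjoint_def)
  have vK: "pverts K = A \<union> B" and aK: "parcs K = parcs (complete_bipartite A B)"
    by (simp_all add: AB(2))
  have Hv: "pverts (pair_Union \<H>) \<inter> (A \<union> B) = {}"
  proof -
    have "pverts L \<inter> pverts K = {}" if "L \<in> \<H>" for L
      using disj K that \<H>_def by (auto simp: pairwise_def disjnt_def)
    with vK show ?thesis by auto
  qed
  have "(x, y) \<in> pverts L \<times> pverts L" if "L \<in> \<H>" "(x, y) \<in> parcs L" for L x y
    using H.parcs_iff H.pverts_eq that by auto
  then have Ha: "parcs (pair_Union \<H>) \<subseteq> (- (A \<union> B)) \<times> (- (A \<union> B))"
    using Hv by fastforce
  have arcs: "parcs (pair_Union \<K>) = parcs (pair_Union \<H>) \<union> parcs (complete_bipartite A B)"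
    using KH(1) aK by auto
  have verts: "pverts (pair_Union \<K>) = pverts (pair_Union \<H>) \<union> (A \<union> B)"
    using KH(1) vK by auto
  show ?case
  proof (cases "W = {}")
    case True
    with AB V12 have V_eq: "V1 = A" "V2 = B" unfolding W_def by blast+
    have P_eq: "P = {A, B}"
    \<comment> \<open>Deleting a third block would leave a choice from both \<open>A\<close> and
      \<open>B\<close>, whose vertices are adjacent.\<close>
    proof (rule ccontr)
      assume "P \<noteq> {A, B}"
      with V V_eq obtain U where U: "U \<in> P" "U \<noteq> A" "U \<noteq> B" by blast
      then have "has_choice (parcs (pair_Union \<K>)) (P - {U})"
        using Suc.prems(7) unfolding minimal_no_choice_def by blast
      then obtain v where v: "\<And>V. V \<in> P - {U} \<Longrightarrow> v V \<in> V"
        "\<And>V V'. V \<in> P - {U} \<Longrightarrow> V' \<in> P - {U} \<Longrightarrow> (v V, v V') \<notin> parcs (pair_Union \<K>)"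
        by (rule has_choiceE) iprover
      have "A \<in> P - {U}" "B \<in> P - {U}" using U V(1,2) V_eq by auto
      with v have "v A \<in> A" "v B \<in> B" "(v A, v B) \<notin> parcs (pair_Union \<K>)" by auto
      with arcs show False by auto
    qed
    have "A \<noteq> B" using V V_eq by blast
    then have "card \<K> = 1" using P_eq Suc.prems(6) by simp
    then have "\<K> = {K}" using K by (metis card_1_singletonE singletonD)
    then have "pair_Union \<K> = complete_bipartite A B"
      using AB(2) by (simp add: pair_Union_def)
    then show ?thesis
      using join_constructible.start[OF AB(1)] P_eq by simp
  next
    case False
    let ?Q = "insert W (P - {V1, V2})"
    have rest: "U \<inter> (V1 \<union> V2) = {}" if "U \<in> P - {V1, V2}" for U
      using disjointD[OF P(2), of U V1] disjointD[OF P(2), of U V2] that V(1,2) by auto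
    have W_sub: "W \<subseteq> V1 \<union> V2" "W \<inter> (A \<union> B) = {}"
      unfolding W_def by blast+
    have W_notin: "W \<notin> P - {V1, V2}"
      using rest[of W] W_sub(1) False by (metis Int_absorb2)
    have Q_disj: "U \<inter> (A \<union> B) = {}" if "U \<in> ?Q" for U
    proof (cases "U = W")
      case True
      with W_sub(2) show ?thesis by simp
    next
      case False
      with that have "U \<inter> (V1 \<union> V2) = {}" by (intro rest) simp
      with AB(3,4) show ?thesis by blast
    qed
    have Q: "\<Union> ?Q = pverts (pair_Union \<H>)"
    proof -
      have "\<Union> P = V1 \<union> V2 \<union> \<Union> (P - {V1, V2})"
        using V(1,2) by blast
      also have "V1 \<union> V2 = W \<union> (A \<union> B)"
        using AB(3,4) unfolding W_def by blast
      finally have "\<Union> P = \<Union> ?Q \<union> (A \<union> B)"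
        by (simp add: Un_ac)
      moreover have "\<Union> ?Q \<inter> (A \<union> B) = {}"
        using Q_disj by blast
      moreover have "Y = Z" if "Y \<union> C = Z \<union> C" "Y \<inter> C = {}" "Z \<inter> C = {}" for Y Z C :: "'a set"
        using that by blast
      ultimately show ?thesis
        using P(1) verts Hv by metis
    qed
    have "disjoint ?Q"
    proof (rule disjointI)
      fix U V assume UV: "U \<in> ?Q" "V \<in> ?Q" "U \<noteq> V"
      have W_rest: "W \<inter> U = {}" if "U \<in> P - {V1, V2}" for U
        using rest[OF that] W_sub(1) by blast
      consider "U = W" "V \<in> P - {V1, V2}" | "V = W" "U \<in> P - {V1, V2}" | "U \<in> P" "V \<in> P"
        using UV by (metis DiffD1 insertE)
      then show "U \<inter> V = {}"
      proof cases
        case 1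
        with W_rest[of V] show ?thesis by simp
      next
        case 2
        with W_rest[of U] show ?thesis by (simp add: Int_commute)
      next
        case 3
        then show ?thesis using disjointD[OF P(2)] UV(3) by simp
      qed
    qed
    then have part: "partition_on (pverts (pair_Union \<H>)) ?Q"
      using Q P(3) False by (simp add: partition_on_def)
    have min: "minimal_no_choice (parcs (pair_Union \<H>)) ?Q"
      using minimal_no_choice_undo_join[OF _ AB(1) Ha P(2,3) V(1-3) AB(3,4) W_def False]
        Suc.prems(7) arcs by simp
    have cardH: "n = card \<H>" "finite \<H>"
      using Suc.hyps(2) K Suc.prems(2) \<H>_def by simp_all
    have "card (P - {V1, V2}) = n"
      using V(1-3) Suc.prems(5,6) Suc.hyps(2) by (simp add: card_Diff_subset)
    then have cardQ: "card ?Q = Suc (card \<H>)"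
      using W_notin Suc.prems(5) cardH by simp
    have "\<H> \<noteq> {}"
      using Q False by auto
    from Suc.hyps(1)[OF cardH(1) H.bipartite_family_axioms cardH(2) this part _ cardQ min]
    have IH: "join_constructible (pair_Union \<H>) ?Q"
      using Suc.prems(5) by simp
    \<comment> \<open>The vertices of \<open>W\<close> sent to \<open>A\<close> are
      \<open>V1 - A\<close>; the remaining ones form \<open>V2 - B\<close>, so the step restores
      \<open>V1\<close> and \<open>V2\<close>.\<close>
    have "join_constructible (pair_Union {pair_Union \<H>, complete_bipartite A B})
        ((?Q - {W}) \<union> {A \<union> (V1 - A), B \<union> (W - (V1 - A))})"
      by (rule join_constructible.join[OF IH _ AB(1)])
        (use Hv V12 AB(4) in \<open>auto simp: disjnt_def W_def\<close>)
    moreover have "pair_Union {pair_Union \<H>, complete_bipartite A B} = pair_Union \<K>"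
      using KH(1) AB(2) by (auto simp: pair_Union_def)
    moreover have "A \<union> (V1 - A) = V1" "B \<union> (W - (V1 - A)) = V2"
      using AB(3,4) V12 unfolding W_def by blast+
    moreover have "(?Q - {W}) \<union> {V1, V2} = P"
      using W_notin V(1,2) by blast
    ultimately show ?thesis by simp
  qed
qed

section \<open>Strongly connected components and the final assembly\<close>

text \<open>Arcs never leave a member of the family, and inside it vertices on the same side are
  linked through the nonempty opposite side. Nonempty disjoint members have distinct vertex sets, so
  none is counted twice.\<close>

lemma (in bipartite_family) card_sccs_eq:
  assumes "pair_graph (pair_Union \<K>)"
  shows "card (pre_digraph.sccs (with_proj (pair_Union \<K>))) = card \<K>"
proof -
  let ?G = "pair_Union \<K>"
  interpret G: pair_graph ?G by fact
  have reach: "u \<rightarrow>\<^sup>*\<^bsub>with_proj ?G\<^esub> w" if K: "K \<in> \<K>" and uw: "u \<in> pverts K" "w \<in> pverts K"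
    for K u w
  proof -
    have adj: "x \<rightarrow>\<^sup>*\<^bsub>with_proj ?G\<^esub> y" if "x \<in> S K b" "y \<in> S K (\<not> b)" for x y b
    proof -
      have "(x, y) \<in> parcs K" using parcs_iff[OF K] that by blast
      with K have "(x, y) \<in> parcs ?G" by auto
      then show ?thesis by (rule G.reachable_adjI)
    qed
    obtain b c where bc: "u \<in> S K b" "w \<in> S K c"
      using uw pverts_eq[OF K] by auto
    show ?thesis
    proof (cases "b = c")
      case True
      obtain z where "z \<in> S K (\<not> b)" using S_nonempty[OF K] by blast
      then have "u \<rightarrow>\<^sup>*\<^bsub>with_proj ?G\<^esub> z" "z \<rightarrow>\<^sup>*\<^bsub>with_proj ?G\<^esub> w"
        using adj[of u b z] adj[of z "\<not> b" w] bc True by simp_all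
      then show ?thesis by (rule G.reachable_trans)
    next
      case False
      with adj[of u b w] bc show ?thesis by (cases b; cases c) auto
    qed
  qed
  have stay: "w \<in> pverts K" if uw: "u \<rightarrow>\<^sup>*\<^bsub>with_proj ?G\<^esub> w" and K: "K \<in> \<K>" "u \<in> pverts K"
    for K u w
    using uw
  proof (induction rule: G.reachable_induct)
    case base
    show ?case by (fact K(2))
  next
    case (step x y)
    then obtain L b where L: "L \<in> \<K>" "x \<in> S L b" "y \<in> S L (\<not> b)"
      using parcs_iff by auto
    moreover obtain c where "x \<in> S K c" using step pverts_eq[OF K(1)] by auto
    ultimately have "L = K" using same_component K(1) by blast
    with L show ?case using pverts_eq by auto
  qed
  have ne: "pverts K \<noteq> {}" if "K \<in> \<K>" for K
    using that pverts_eq S_nonempty by fastforce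
  have "G.sccs_verts = pverts ` \<K>"
  proof (intro equalityI subsetI)
    fix T assume "T \<in> G.sccs_verts"
    then have T: "T \<noteq> {}" "\<And>u w. u \<in> T \<Longrightarrow> w \<in> T \<Longrightarrow> u \<rightarrow>\<^sup>*\<^bsub>with_proj ?G\<^esub> w"
      "\<And>u w. u \<in> T \<Longrightarrow> u \<rightarrow>\<^sup>*\<^bsub>with_proj ?G\<^esub> w \<Longrightarrow> w \<rightarrow>\<^sup>*\<^bsub>with_proj ?G\<^esub> u \<Longrightarrow> w \<in> T"
      unfolding G.in_sccs_verts_conv_reachable by metis+
    then obtain u where u: "u \<in> T" by blast
    then have "u \<in> pverts ?G"
      using T(2)[of u u] G.reachable_in_verts(1)[of u u] by simp
    then obtain K where K: "K \<in> \<K>" "u \<in> pverts K" by auto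
    have "T = pverts K"
    proof (intro equalityI subsetI)
      show "w \<in> pverts K" if "w \<in> T" for w
        using stay[OF T(2)[OF u that] K] .
      show "w \<in> T" if "w \<in> pverts K" for w
        using T(3)[OF u] reach[OF K(1)] K(2) that by simp
    qed
    with K show "T \<in> pverts ` \<K>" by blast
  next
    fix T assume "T \<in> pverts ` \<K>"
    then obtain K where "K \<in> \<K>" "T = pverts K" by blast
    then show "T \<in> G.sccs_verts"
      unfolding G.in_sccs_verts_conv_reachable using reach stay ne by metis
  qed
  moreover have "inj_on pverts \<K>"
  proof (rule inj_onI, rule ccontr)
    fix K L assume KL: "K \<in> \<K>" "L \<in> \<K>" "pverts K = pverts L" "K \<noteq> L"
    from pairwiseD[OF disj KL(1,2,4)] have "disjnt (pverts K) (pverts L)" .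
    with KL(3) ne[OF KL(1)] show False
      by (simp add: disjnt_def)
  qed
  ultimately show ?thesis
    using G.card_sccs_verts by (simp add: card_image)
qed

theorem theorem19:
  fixes G :: "'a pair_pre_digraph" and P :: "'a set set" and r :: nat
  assumes "pair_graph G"
    and "partition_on (pverts G) P"
    and "card P = r" and "r \<ge> 2"
    and "block_minimal_no_IT (with_proj G) P"
    and "disjoint_union_of_complete_bipartite G"
    and "card (pre_digraph.sccs (with_proj G)) = r - 1"
  shows "join_constructible G P"
proof -
  obtain \<K> where \<K>: "\<forall>K\<in>\<K>. \<exists>A B. bipartition_parts A B \<and> K = complete_bipartite A B"
      "pairwise (\<lambda>K L. disjnt (pverts K) (pverts L)) \<K>" and G: "G = pair_Union \<K>"
    using assms(6) unfolding disjoint_union_of_complete_bipartite_def by blast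
  from \<K>(1) have "\<forall>K\<in>\<K>. \<exists>p. bipartition_parts (fst p) (snd p) \<and> K = complete_bipartite (fst p) (snd p)"
    by (metis fst_conv snd_conv)
  from bchoice[OF this] obtain p where AB: "\<forall>K\<in>\<K>. bipartition_parts (fst (p K)) (snd (p K))
      \<and> K = complete_bipartite (fst (p K)) (snd (p K))" ..
  interpret bipartite_family \<K> "\<lambda>K b. if b then fst (p K) else snd (p K)"
  proof
    show "bipartition_parts (if True then fst (p K) else snd (p K)) (if False then fst (p K) else snd (p K))"
      if "K \<in> \<K>" for K
      using bspec[OF AB that] by simp
    show "K = complete_bipartite (if True then fst (p K) else snd (p K)) (if False then fst (p K) else snd (p K))"
      if "K \<in> \<K>" for K
      unfolding if_True if_False using bspec[OF AB that] by blast
  qed (fact \<K>(2))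
  have "card \<K> = r - 1"
    using card_sccs_eq assms(1,7) G by simp
  \<comment> \<open>Here \<open>r \<ge> 2\<close> makes the subtraction exact and
    \<open>r - 1\<close> positive. Infinite sets have cardinality 0, so positivity also yields
    finiteness of \<open>\<K>\<close> and \<open>P\<close>.\<close>
  then have card: "card P = Suc (card \<K>)" "card \<K> > 0"
    using assms(3,4) by auto
  then have fin: "finite \<K>" "\<K> \<noteq> {}" "finite P"
    by (auto intro: card_ge_0_finite)
  show ?thesis
    using join_constructible_pair_Union[OF bipartite_family_axioms fin(1,2) _ fin(3) card(1)]
      block_minimal_no_IT_imp_minimal_no_choice assms(2,5) G by metis
qed

end
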